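(* Let $\mathcal D=\{\mathbf p_1,\dots,\mathbf p_M\}\subset\mathbb R^d$ be a finite set of data points, let $C^*\in\{-,+\}^M$ be a target dichotomy, and let $\Sigma_{\mathcal D}$ be the polyhedral fan in $\mathbb R^{d+1}$ induced by the hyperplane arrangement $\mathcal H_{\mathcal D}=\bigcup_{i=1}^M(1,\mathbf p_i)^\perp$. (1) If the data is linearly separable (according to $C^*$), then the sublevel sets $\Sigma^{\le k}_{\mathcal D}$ of the $0/1$-loss function are connected through walls of codimension $1$ for any $k\ge 0$. (2) Conversely, if the data is not linearly separable (according to $C^*$) and the set of minimizers of the $0/1$-loss function consists of more than one maximal cone, then it is not connected through walls of codimension $1$. (3) Moreover, if $\sigma,\sigma'$ are distinct maximal cones which are local minima of the $0/1$-loss, if $m=\operatorname{err}_{C^*}(\sigma)$ denotes the minimum error, and if $\sigma,\sigma_1,\dots,\sigma_l,\sigma'$ forms a path, then $\operatorname{err}_{C^*}$ is bounded from above along this path by $m+\lfloor\frac{l+1}{2}\rfloor$.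
   Context: For $\theta=(a,\mathbf s)\in\mathbb R\times\mathbb R^d\cong\mathbb R^{d+1}$ let $f_\theta(\mathbf x)=\operatorname{sgn}(\langle \mathbf s,\mathbf x\rangle+a)\in\{-1,0,1\}$. For $\mathbf p\in\mathbb R^d$, $(1,\mathbf p)^\perp=\{(a,\mathbf s)\in\mathbb R^{d+1}\mid a+\langle\mathbf s,\mathbf p\rangle=0\}$. The arrangement $\mathcal H_{\mathcal D}$ induces a complete polyhedral fan $\Sigma_{\mathcal D}$, whose maximal cones are the Euclidean closures of the connected components of $\mathbb R^{d+1}\setminus\mathcal H_{\mathcal D}$. A wall is an intersection of maximal cones that has codimension $1$. The $0/1$-loss function is $\operatorname{err}_{C^*}(\theta)=|\{i\in\{1,\dots,M\}\mid \operatorname{sgn}(f_\theta(\mathbf p_i))=-C^*_i\}|$ (data points on the classifying hyperplane are counted as correctly classified). It is constant on relative interiors of cones of $\Sigma_{\mathcal D}$, and $\operatorname{err}_{C^*}(\sigma)$ denotes its value on the relative interior of $\sigma$. The $k$-th level set is $\Sigma^k_{\mathcal D}=\{\sigma\in\Sigma_{\mathcal D}\mid\operatorname{err}_{C^*}(\sigma)=k\}$, and the sublevel set is $\Sigma^{\le k}_{\mathcal D}=\bigcup_{l=0}^k\Sigma^l_{\mathcal D}$. Minimizers, minima and the minimum error are understood with respect to maximal cones (values of the loss on interiors of maximal cones); a maximal cone is a local minimum if no maximal cone sharing a wall of codimension $1$ with it has smaller error. The data is linearly separable according to $C^*$ if there is a hyperplane separating it into $\{\mathbf p_i\mid C^*_i=+\}$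 and $\{\mathbf p_i\mid C^*_i=-\}$, i.e. there is $\theta$ such that $f_\theta(\mathbf p_i)$ has sign $C^*_i$ for all $i$. A sequence $\sigma_1,\dots,\sigma_k$ of maximal cones forms a path connecting $\sigma_1$ and $\sigma_k$ if $\sigma_i,\sigma_{i+1}$ intersect in a wall of codimension $1$ for all $i\in\{1,\dots,k-1\}$. A collection of cones is connected through walls of codimension $1$ if any two of its maximal (full-dimensional) cones are connected by a path consisting of maximal cones of the collection.
   Formalization: In (3) both local minima σ and σ' are required to have the same error m (m need not be the global minimum); if σ' is only a local minimum with larger error, the stated bound can fail. *)

theory Defs
  imports "HOL-Analysis.Analysis"
begin

text \<open>
  The data are \<open>p i\<close> for \<open>i \<in> {1..M}\<close>, and the target dichotomy is \<open>C i \<in> {-1, 1}\<close> for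
  \<open>i \<in> {1..M}\<close>. Parameters \<open>(a, s)\<close> live in \<open>real \<times> real ^ 'd\<close>, of dimension \<open>d + 1\<close>.
\<close>

type_synonym 'd param = "real \<times> (real ^ 'd)"

definition classifier :: "'d::finite param \<Rightarrow> real ^ 'd \<Rightarrow> real" where
  "classifier \<theta> x = sgn (snd \<theta> \<bullet> x + fst \<theta>)"

definition dual_hyperplane :: "real ^ 'd::finite \<Rightarrow> 'd param set" where
  "dual_hyperplane q = {(a, s). a + s \<bullet> q = 0}"

definition arrangement :: "nat \<Rightarrow> (nat \<Rightarrow> real ^ 'd::finite) \<Rightarrow> 'd param set" where
  "arrangement M p = (\<Union>i\<in>{1..M}. dual_hyperplane (p i))"

definition maximal_cones :: "nat \<Rightarrow> (nat \<Rightarrow> real ^ 'd::finite) \<Rightarrow> 'd param set set" where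
  "maximal_cones M p = closure ` components (- arrangement M p)"

text \<open>\<open>face_of\<close> admits the empty set as a face; a fan consists of nonempty cones.\<close>

definition fan :: "nat \<Rightarrow> (nat \<Rightarrow> real ^ 'd::finite) \<Rightarrow> 'd param set set" where
  "fan M p = {F. F \<noteq> {} \<and> (\<exists>\<sigma>\<in>maximal_cones M p. F face_of \<sigma>)}"

definition is_wall :: "nat \<Rightarrow> (nat \<Rightarrow> real ^ 'd::finite) \<Rightarrow> 'd param set \<Rightarrow> bool" where
  "is_wall M p W \<longleftrightarrow>
     (\<exists>S. S \<noteq> {} \<and> S \<subseteq> maximal_cones M p \<and> W = \<Inter>S) \<and>
     aff_dim W = int DIM('d param) - 1"

definition err :: "nat \<Rightarrow> (nat \<Rightarrow> real ^ 'd::finite) \<Rightarrow> (nat \<Rightarrow> real) \<Rightarrow> 'd param \<Rightarrow> nat" where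
  "err M p C \<theta> = card {i \<in> {1..M}. sgn (classifier \<theta> (p i)) = - C i}"

text \<open>The loss is constant on relative interiors of cones of the fan, so for such a cone the
  following description is uniquely satisfied.\<close>

definition err_cone ::
    "nat \<Rightarrow> (nat \<Rightarrow> real ^ 'd::finite) \<Rightarrow> (nat \<Rightarrow> real) \<Rightarrow> 'd param set \<Rightarrow> nat" where
  "err_cone M p C \<sigma> = (THE k. \<forall>\<theta>\<in>rel_interior \<sigma>. err M p C \<theta> = k)"

definition level_set ::
    "nat \<Rightarrow> (nat \<Rightarrow> real ^ 'd::finite) \<Rightarrow> (nat \<Rightarrow> real) \<Rightarrow> nat \<Rightarrow> 'd param set set" where
  "level_set M p C k = {\<sigma> \<in> fan M p. err_cone M p C \<sigma> = k}"

definition sublevel_set ::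
    "nat \<Rightarrow> (nat \<Rightarrow> real ^ 'd::finite) \<Rightarrow> (nat \<Rightarrow> real) \<Rightarrow> nat \<Rightarrow> 'd param set set" where
  "sublevel_set M p C k = (\<Union>l\<in>{0..k}. level_set M p C l)"

definition minimizers ::
    "nat \<Rightarrow> (nat \<Rightarrow> real ^ 'd::finite) \<Rightarrow> (nat \<Rightarrow> real) \<Rightarrow> 'd param set set" where
  "minimizers M p C = {\<sigma> \<in> maximal_cones M p.
     \<forall>\<tau>\<in>maximal_cones M p. err_cone M p C \<sigma> \<le> err_cone M p C \<tau>}"

definition local_minimum ::
    "nat \<Rightarrow> (nat \<Rightarrow> real ^ 'd::finite) \<Rightarrow> (nat \<Rightarrow> real) \<Rightarrow> 'd param set \<Rightarrow> bool" where
  "local_minimum M p C \<sigma> \<longleftrightarrow> \<sigma> \<in> maximal_cones M p \<and>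
     \<not> (\<exists>\<tau>\<in>maximal_cones M p. is_wall M p (\<sigma> \<inter> \<tau>) \<and> err_cone M p C \<tau> < err_cone M p C \<sigma>)"

definition linearly_separable ::
    "nat \<Rightarrow> (nat \<Rightarrow> real ^ 'd::finite) \<Rightarrow> (nat \<Rightarrow> real) \<Rightarrow> bool" where
  "linearly_separable M p C \<longleftrightarrow> (\<exists>\<theta>. \<forall>i\<in>{1..M}. classifier \<theta> (p i) = C i)"

definition is_path ::
    "nat \<Rightarrow> (nat \<Rightarrow> real ^ 'd::finite) \<Rightarrow> 'd param set list \<Rightarrow> bool" where
  "is_path M p \<sigma>s \<longleftrightarrow> \<sigma>s \<noteq> [] \<and> set \<sigma>s \<subseteq> maximal_cones M p \<and>
     (\<forall>i. Suc i < length \<sigma>s \<longrightarrow> is_wall M p (\<sigma>s ! i \<inter> \<sigma>s ! Suc i))"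

definition connected_through_walls ::
    "nat \<Rightarrow> (nat \<Rightarrow> real ^ 'd::finite) \<Rightarrow> 'd param set set \<Rightarrow> bool" where
  "connected_through_walls M p S \<longleftrightarrow>
     (\<forall>\<sigma>\<in>S \<inter> maximal_cones M p. \<forall>\<sigma>'\<in>S \<inter> maximal_cones M p.
        \<exists>\<sigma>s. is_path M p \<sigma>s \<and> set \<sigma>s \<subseteq> S \<and> hd \<sigma>s = \<sigma> \<and> last \<sigma>s = \<sigma>')"

end

theory Submission
  imports Defs
begin

text \<open>
  A point outside the arrangement is recorded by its sign vector, the list of the sides of the
  hyperplanes on which it lies. Maximal cones correspond to the sign vectors that occur, and on
  the interior of a cone the loss is the Hamming distance of its sign vector from \<open>C\<close>.

  The hyperplanes have the normals \<open>(1, p i)\<close>, which are pairwise linearly independent because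
  the data points are distinct. Two hyperplanes therefore meet in codimension two, so crossing
  a wall of codimension one flips exactly one sign (\<open>wall_flips_one_sign\<close>) and changes the loss
  by exactly one (\<open>wall_changes_err_by_one\<close>).

  This parity phenomenon gives the last two claims. Neighbouring cones never have equal loss, so
  no two minimizers are adjacent and a path between different ones has to leave the set of
  minimizers; and a path with \<open>l\<close> intermediate cones, both ends of
  which have loss \<open>m\<close>, reaches at most height \<open>m + (l + 1) div 2\<close>, since each cone on it is at most
  \<open>(l + 1) div 2\<close> steps away from one of the ends.

  For separable data, let \<open>c\<close> be a separating parameter. It lies in the only cone with loss zero.
  From a point of any other cone walk straight towards \<open>c\<close>. A line segment meets each
  hyperplane at most once, and only those that separate its ends, so each crossing corrects a
  sign. After moving the starting point slightly, no two hyperplanes are crossed at the same time,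
  so the first crossing passes through a wall and lowers the loss (\<open>descent_towards_separator\<close>).
  Repeating this connects every cone to the one of \<open>c\<close> without ever raising the loss, hence inside
  every sublevel set that contains the starting cone.
\<close>

section \<open>Chambers and their sign vectors\<close>

text \<open>
  A constant of its own, so that \<open>normal q \<bullet> \<theta>\<close> stays a linear functional of \<open>\<theta>\<close> instead of being
  split into the coordinates of the pair.
\<close>

definition normal :: "real ^ 'd::finite \<Rightarrow> 'd param" where
  "normal q = (1, q)"

definition side :: "real ^ 'd::finite \<Rightarrow> 'd param \<Rightarrow> real" where
  "side q \<theta> = sgn (normal q \<bullet> \<theta>)"

text \<open>
  Chambers are indexed by a point rather than by a sign vector, so that they are never empty and
  every sign vector in sight is realized.
\<close>

definition chamber :: "nat \<Rightarrow> (nat \<Rightarrow> real ^ 'd::finite) \<Rightarrow> 'd param \<Rightarrow> 'd param set" where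
  "chamber M p \<theta> = {\<eta>. \<forall>i\<in>{1..M}. side (p i) \<eta> = side (p i) \<theta>}"

lemma classifier_eq_side: "classifier \<theta> q = side q \<theta>"
  by (cases \<theta>) (simp add: classifier_def side_def normal_def inner_commute add.commute)

lemma side_eq_0_iff: "side q \<theta> = 0 \<longleftrightarrow> normal q \<bullet> \<theta> = 0"
  by (simp add: side_def sgn_zero_iff)

lemma dual_hyperplane_eq: "dual_hyperplane q = {\<theta>. normal q \<bullet> \<theta> = 0}"
  by (auto simp: dual_hyperplane_def normal_def inner_commute)

lemma notin_arrangement_iff:
  "\<theta> \<notin> arrangement M p \<longleftrightarrow> (\<forall>i\<in>{1..M}. side (p i) \<theta> \<noteq> 0)"
  by (simp add: arrangement_def dual_hyperplane_eq side_eq_0_iff)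

lemma err_eq_card_side: "err M p C \<theta> = card {i \<in> {1..M}. side (p i) \<theta> = - C i}"
  by (simp add: err_def classifier_eq_side) (simp add: side_def)

lemma self_in_chamber [simp]: "\<theta> \<in> chamber M p \<theta>"
  by (simp add: chamber_def)

lemma chamber_eq: "\<eta> \<in> chamber M p \<theta> \<Longrightarrow> chamber M p \<eta> = chamber M p \<theta>"
  by (auto simp: chamber_def)

lemma chamber_disjoint_arrangement:
  assumes "\<theta> \<notin> arrangement M p" "\<eta> \<in> chamber M p \<theta>"
  shows "\<eta> \<notin> arrangement M p"
  using assms by (auto simp: notin_arrangement_iff chamber_def)

lemma sgn_eq_iff_mult:
  fixes a :: real
  assumes "a \<noteq> 0"
  shows "sgn b = sgn a \<longleftrightarrow> 0 < sgn a * b"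
  using assms by (auto simp: sgn_real_def)

lemma open_convex_same_sides:
  assumes "finite J" "\<And>i. i \<in> J \<Longrightarrow> side (p i) \<theta> \<noteq> 0"
  shows "open {\<eta>. \<forall>i\<in>J. side (p i) \<eta> = side (p i) \<theta>}"
    and "convex {\<eta>. \<forall>i\<in>J. side (p i) \<eta> = side (p i) \<theta>}"
proof -
  have eq: "{\<eta>. \<forall>i\<in>J. side (p i) \<eta> = side (p i) \<theta>} =
      (\<Inter>i\<in>J. {\<eta>. (side (p i) \<theta> *\<^sub>R normal (p i)) \<bullet> \<eta> > 0})"
    using assms(2) unfolding side_def
    by (auto simp: sgn_eq_iff_mult sgn_zero_iff)
  show "open {\<eta>. \<forall>i\<in>J. side (p i) \<eta> = side (p i) \<theta>}"
    unfolding eq using assms(1) by (intro open_INT ballI open_halfspace_gt)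
  show "convex {\<eta>. \<forall>i\<in>J. side (p i) \<eta> = side (p i) \<theta>}"
    unfolding eq by (intro convex_INT convex_halfspace_gt)
qed

lemma open_convex_chamber:
  assumes "\<theta> \<notin> arrangement M p"
  shows "open (chamber M p \<theta>)" "convex (chamber M p \<theta>)"
  using assms open_convex_same_sides[of "{1..M}" p \<theta>]
  by (auto simp: chamber_def notin_arrangement_iff)

text \<open>
  A connected set that avoids the arrangement cannot change sides, by the intermediate value
  theorem, while a chamber is itself connected, being convex.
\<close>

lemma component_eq_chamber:
  assumes "\<theta> \<notin> arrangement M p"
  shows "connected_component_set (- arrangement M p) \<theta> = chamber M p \<theta>"
proof
  show "chamber M p \<theta> \<subseteq> connected_component_set (- arrangement M p) \<theta>"
    using assms chamber_disjoint_arrangement[OF assms] open_convex_chamber(2)[OF assms]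
    by (intro connected_component_maximal convex_connected) auto
next
  let ?K = "connected_component_set (- arrangement M p) \<theta>"
  show "?K \<subseteq> chamber M p \<theta>"
  proof
    fix \<eta> assume \<eta>: "\<eta> \<in> ?K"
    have \<theta>: "\<theta> \<in> ?K"
      using assms by (simp add: connected_component_refl)
    have "side (p i) \<eta> = side (p i) \<theta>" if i: "i \<in> {1..M}" for i
    proof (rule ccontr)
      assume neq: "side (p i) \<eta> \<noteq> side (p i) \<theta>"
      have nz: "normal (p i) \<bullet> x \<noteq> 0" if "x \<in> ?K" for x
        using that i connected_component_subset[of "- arrangement M p" \<theta>]
        by (auto simp: notin_arrangement_iff side_eq_0_iff)
      have "\<exists>x\<in>?K. normal (p i) \<bullet> x = 0"
      proof (cases "normal (p i) \<bullet> \<theta> < 0")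
        case True
        then have "normal (p i) \<bullet> \<eta> \<ge> 0"
          using neq by (auto simp: side_def sgn_real_def split: if_splits)
        then show ?thesis
          using connected_ivt_hyperplane[OF connected_connected_component \<theta> \<eta>] True
          by simp
      next
        case False
        then have "normal (p i) \<bullet> \<eta> \<le> 0"
          using neq nz[OF \<theta>] by (auto simp: side_def sgn_real_def split: if_splits)
        then show ?thesis
          using connected_ivt_hyperplane[OF connected_connected_component \<eta> \<theta>] False
          by simp
      qed
      with nz show False by blast
    qed
    then show "\<eta> \<in> chamber M p \<theta>" by (simp add: chamber_def)
  qed
qed

lemma maximal_cones_eq:
  "maximal_cones M p = (\<lambda>\<theta>. closure (chamber M p \<theta>)) ` (- arrangement M p)"
proof -
  have "components (- arrangement M p) = chamber M p ` (- arrangement M p)"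
    unfolding components_def by (intro image_cong) (simp_all add: component_eq_chamber)
  then show ?thesis by (simp add: maximal_cones_def image_image)
qed

text \<open>
  Passing to the closure relaxes the strict inequalities of a chamber to weak ones. Points of an
  intersection of two cones can thus be recognized by signs alone.
\<close>

lemma closure_chamber_eq:
  assumes "\<theta> \<notin> arrangement M p"
  shows "closure (chamber M p \<theta>) = {\<eta>. \<forall>i\<in>{1..M}. 0 \<le> side (p i) \<theta> * (normal (p i) \<bullet> \<eta>)}"
    (is "_ = ?P")
proof
  have *: "?P = (\<Inter>i\<in>{1..M}. {\<eta>. (side (p i) \<theta> *\<^sub>R normal (p i)) \<bullet> \<eta> \<ge> 0})"
    by auto
  have "chamber M p \<theta> \<subseteq> ?P"
  proof (intro subsetI CollectI ballI)
    fix \<eta> i assume "\<eta> \<in> chamber M p \<theta>" "i \<in> {1..M}"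
    then have "side (p i) \<theta> = side (p i) \<eta>" by (simp add: chamber_def)
    then show "0 \<le> side (p i) \<theta> * (normal (p i) \<bullet> \<eta>)"
      by (simp add: side_def sgn_real_def)
  qed
  moreover have "closed ?P"
    unfolding * by (intro closed_INT ballI closed_halfspace_ge)
  ultimately show "closure (chamber M p \<theta>) \<subseteq> ?P"
    by (rule closure_minimal)
next
  show "?P \<subseteq> closure (chamber M p \<theta>)"
  proof
    fix \<eta> assume \<eta>: "\<eta> \<in> ?P"
    show "\<eta> \<in> closure (chamber M p \<theta>)"
    proof (cases "\<eta> = \<theta>")
      case True
      then show ?thesis using closure_subset[of "chamber M p \<theta>"] by auto
    next
      case False
      \<comment> \<open>Points between a point of the open chamber and a weakly admissible point are strictly
          admissible.\<close>
      have "open_segment \<theta> \<eta> \<subseteq> chamber M p \<theta>"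
      proof
        fix x assume "x \<in> open_segment \<theta> \<eta>"
        then obtain u where u: "0 < u" "u < 1" "x = (1 - u) *\<^sub>R \<theta> + u *\<^sub>R \<eta>"
          by (auto simp: in_segment)
        have "side (p i) x = side (p i) \<theta>" if i: "i \<in> {1..M}" for i
        proof -
          have nz: "normal (p i) \<bullet> \<theta> \<noteq> 0"
            using assms i by (auto simp: notin_arrangement_iff side_eq_0_iff)
          have "side (p i) \<theta> * (normal (p i) \<bullet> x) =
              (1 - u) * (side (p i) \<theta> * (normal (p i) \<bullet> \<theta>)) + u * (side (p i) \<theta> * (normal (p i) \<bullet> \<eta>))"
            unfolding u(3) by (simp add: inner_add_right algebra_simps)
          moreover have "side (p i) \<theta> * (normal (p i) \<bullet> \<theta>) > 0"
            using nz unfolding side_def by (simp add: sgn_eq_iff_mult[symmetric])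
          moreover have "0 \<le> u * (side (p i) \<theta> * (normal (p i) \<bullet> \<eta>))"
            using \<eta> i u by simp
          ultimately have "0 < side (p i) \<theta> * (normal (p i) \<bullet> x)"
            using u by (simp add: add_pos_nonneg)
          then show ?thesis
            using nz unfolding side_def by (simp add: sgn_eq_iff_mult)
        qed
        then show "x \<in> chamber M p \<theta>" by (simp add: chamber_def)
      qed
      then have "closure (open_segment \<theta> \<eta>) \<subseteq> closure (chamber M p \<theta>)"
        by (rule closure_mono)
      then show ?thesis using False by (auto simp: closure_open_segment)
    qed
  qed
qed

lemma err_cone_chamber:
  assumes "\<theta> \<notin> arrangement M p"
  shows "err_cone M p C (closure (chamber M p \<theta>)) = err M p C \<theta>"
proof -
  have interior: "rel_interior (closure (chamber M p \<theta>)) = chamber M p \<theta>"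
    using open_convex_chamber[OF assms]
    by (simp add: convex_rel_interior_closure rel_interior_open)
  have const: "err M p C \<eta> = err M p C \<theta>" if "\<eta> \<in> chamber M p \<theta>" for \<eta>
    unfolding err_eq_card_side using that
    by (intro arg_cong[of _ _ card]) (auto simp: chamber_def)
  have "err_cone M p C (closure (chamber M p \<theta>)) =
      (THE k. \<forall>\<eta>\<in>chamber M p \<theta>. err M p C \<eta> = k)"
    by (simp only: err_cone_def interior)
  also have "\<dots> = err M p C \<theta>"
  proof (rule the_equality)
    show "\<forall>\<eta>\<in>chamber M p \<theta>. err M p C \<eta> = err M p C \<theta>" using const by (rule ballI)
    show "k = err M p C \<theta>" if "\<forall>\<eta>\<in>chamber M p \<theta>. err M p C \<eta> = k" for k
      using bspec[OF that self_in_chamber] by (rule sym)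
  qed
  finally show ?thesis .
qed

lemma maximal_cone_in_fan: "\<sigma> \<in> maximal_cones M p \<Longrightarrow> \<sigma> \<in> fan M p"
proof -
  assume \<sigma>: "\<sigma> \<in> maximal_cones M p"
  then obtain \<theta> where \<theta>: "\<theta> \<notin> arrangement M p" "\<sigma> = closure (chamber M p \<theta>)"
    by (auto simp: maximal_cones_eq)
  then have "\<sigma> \<noteq> {}"
    using self_in_chamber[of \<theta> M p] by (metis closure_eq_empty empty_iff)
  moreover have "\<sigma> face_of \<sigma>"
    unfolding \<theta>(2) by (intro face_of_refl convex_closure open_convex_chamber(2) \<theta>(1))
  ultimately show "\<sigma> \<in> fan M p"
    using \<sigma> by (auto simp: fan_def)
qed

lemma maximal_cone_in_sublevel_set_iff:
  assumes "\<sigma> \<in> maximal_cones M p"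
  shows "\<sigma> \<in> sublevel_set M p C k \<longleftrightarrow> err_cone M p C \<sigma> \<le> k"
  using maximal_cone_in_fan[OF assms] by (auto simp: sublevel_set_def level_set_def)

section \<open>Walls\<close>

lemma aff_dim_dual_hyperplane:
  fixes q :: "real ^ 'd::finite"
  shows "aff_dim (dual_hyperplane q) = int DIM('d param) - 1"
proof -
  have "normal q \<noteq> 0" by (simp add: normal_def zero_prod_def)
  then show ?thesis
    unfolding dual_hyperplane_eq by (simp add: aff_dim_hyperplane)
qed

text \<open>
  Distinct data points give distinct linear hyperplanes: the point
  \<open>(- q \<bullet> (r - q), r - q)\<close> lies on the first one, and its inner product with \<open>normal r\<close> is the
  squared distance of \<open>q\<close> and \<open>r\<close>.
\<close>

lemma aff_dim_two_dual_hyperplanes: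
  fixes q r :: "real ^ 'd::finite"
  assumes "q \<noteq> r"
  shows "aff_dim (dual_hyperplane q \<inter> dual_hyperplane r) < int DIM('d param) - 1"
proof -
  let ?U = "dual_hyperplane q \<inter> dual_hyperplane r"
  have sub: "subspace (dual_hyperplane q)" "subspace ?U"
    unfolding dual_hyperplane_eq by (intro subspace_hyperplane subspace_inter)+
  let ?x = "(- (q \<bullet> (r - q)), r - q)"
  have "normal r \<bullet> ?x = (r - q) \<bullet> (r - q)"
    by (simp add: normal_def inner_diff_left)
  then have "?x \<in> dual_hyperplane q" "?x \<notin> dual_hyperplane r"
    using assms by (simp_all add: dual_hyperplane_eq) (simp add: normal_def)
  then have "span ?U \<subset> span (dual_hyperplane q)"
    unfolding sub[THEN span_eq_iff[THEN iffD2]] by blast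
  then have "dim ?U < dim (dual_hyperplane q)" by (rule dim_psubset)
  then show ?thesis
    using aff_dim_dual_hyperplane[of q] sub by (simp add: aff_dim_subspace)
qed

lemma closures_meet_in_separating_hyperplane:
  assumes "\<theta> \<notin> arrangement M p" "\<eta> \<notin> arrangement M p"
    and "i \<in> {1..M}" "side (p i) \<theta> \<noteq> side (p i) \<eta>"
  shows "closure (chamber M p \<theta>) \<inter> closure (chamber M p \<eta>) \<subseteq> dual_hyperplane (p i)"
proof
  fix x assume "x \<in> closure (chamber M p \<theta>) \<inter> closure (chamber M p \<eta>)"
  then have "0 \<le> side (p i) \<theta> * (normal (p i) \<bullet> x)" "0 \<le> side (p i) \<eta> * (normal (p i) \<bullet> x)"
    using assms by (auto simp: closure_chamber_eq)
  moreover have "side (p i) \<theta> \<noteq> 0" "side (p i) \<eta> \<noteq> 0"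
    using assms by (auto simp: notin_arrangement_iff)
  ultimately show "x \<in> dual_hyperplane (p i)"
    using assms(4)
    by (auto simp: side_def sgn_real_def dual_hyperplane_eq split: if_splits)
qed

text \<open>
  With no flipped sign the two cones coincide and their intersection has full dimension; with two
  flipped signs it lies in two distinct hyperplanes and has codimension at least two.
\<close>

lemma wall_flips_one_sign:
  fixes p :: "nat \<Rightarrow> real ^ 'd::finite"
  assumes inj: "inj_on p {1..M}"
    and \<theta>: "\<theta> \<notin> arrangement M p" and \<eta>: "\<eta> \<notin> arrangement M p"
    and wall: "is_wall M p (closure (chamber M p \<theta>) \<inter> closure (chamber M p \<eta>))"
  obtains i where "i \<in> {1..M}" "side (p i) \<theta> \<noteq> side (p i) \<eta>"
    "\<And>j. j \<in> {1..M} \<Longrightarrow> j \<noteq> i \<Longrightarrow> side (p j) \<theta> = side (p j) \<eta>"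
proof -
  let ?W = "closure (chamber M p \<theta>) \<inter> closure (chamber M p \<eta>)"
  have dim: "aff_dim ?W = int DIM('d param) - 1"
    using wall by (simp add: is_wall_def)
  have "\<exists>i\<in>{1..M}. side (p i) \<theta> \<noteq> side (p i) \<eta>"
  proof (rule ccontr)
    assume "\<not> ?thesis"
    then have "\<eta> \<in> chamber M p \<theta>" by (simp add: chamber_def)
    then have "?W = closure (chamber M p \<theta>)" by (simp add: chamber_eq)
    moreover have "aff_dim (chamber M p \<theta>) = int DIM('d param)"
      using open_convex_chamber(1)[OF \<theta>] self_in_chamber[of \<theta> M p] by (intro aff_dim_open) blast+
    ultimately show False using dim by simp
  qed
  then obtain i where i: "i \<in> {1..M}" "side (p i) \<theta> \<noteq> side (p i) \<eta>" by blast
  have "side (p j) \<theta> = side (p j) \<eta>" if j: "j \<in> {1..M}" "j \<noteq> i" for j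
  proof (rule ccontr)
    assume "side (p j) \<theta> \<noteq> side (p j) \<eta>"
    then have "?W \<subseteq> dual_hyperplane (p i) \<inter> dual_hyperplane (p j)"
      using closures_meet_in_separating_hyperplane[OF \<theta> \<eta>] i j by blast
    then have "aff_dim ?W \<le> aff_dim (dual_hyperplane (p i) \<inter> dual_hyperplane (p j))"
      by (rule aff_dim_subset)
    moreover have "p i \<noteq> p j" using inj i j by (auto dest: inj_onD)
    ultimately show False using aff_dim_two_dual_hyperplanes[of "p i" "p j"] dim by simp
  qed
  with i show thesis by (rule that)
qed

text \<open>
  Conversely, two chambers that differ in one sign share a wall if the common hyperplane contains
  a point \<open>x\<close> which has the common strict signs with respect to all the others: a relative
  neighbourhood of \<open>x\<close> in the hyperplane lies in both closures.
\<close>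

lemma is_wall_one_flip:
  fixes p :: "nat \<Rightarrow> real ^ 'd::finite"
  assumes \<theta>: "\<theta> \<notin> arrangement M p" and \<eta>: "\<eta> \<notin> arrangement M p"
    and i: "i \<in> {1..M}" "side (p i) \<theta> \<noteq> side (p i) \<eta>" "normal (p i) \<bullet> x = 0"
    and x: "\<And>j. j \<in> {1..M} - {i} \<Longrightarrow> side (p j) x = side (p j) \<theta>"
    and \<eta>_eq: "\<And>j. j \<in> {1..M} - {i} \<Longrightarrow> side (p j) \<eta> = side (p j) \<theta>"
  shows "is_wall M p (closure (chamber M p \<theta>) \<inter> closure (chamber M p \<eta>))"
proof -
  let ?W = "closure (chamber M p \<theta>) \<inter> closure (chamber M p \<eta>)"
  let ?V = "{y. \<forall>j\<in>{1..M} - {i}. side (p j) y = side (p j) \<theta>}"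
  let ?H = "dual_hyperplane (p i)"
  have "open ?V"
    using \<theta> by (intro open_convex_same_sides) (auto simp: notin_arrangement_iff)
  have V_mem: "y \<in> closure (chamber M p \<zeta>)"
    if "y \<in> ?H \<inter> ?V" "\<zeta> \<notin> arrangement M p"
      and \<zeta>: "\<And>j. j \<in> {1..M} - {i} \<Longrightarrow> side (p j) \<zeta> = side (p j) \<theta>" for y \<zeta>
  proof -
    have "0 \<le> side (p j) \<zeta> * (normal (p j) \<bullet> y)" if j: "j \<in> {1..M}" for j
    proof (cases "j = i")
      case True
      then show ?thesis using \<open>y \<in> ?H \<inter> ?V\<close> by (simp add: dual_hyperplane_eq)
    next
      case False
      then have "side (p j) \<zeta> = side (p j) y"
        using \<open>y \<in> ?H \<inter> ?V\<close> \<zeta>[of j] j by auto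
      then show ?thesis
        by (simp add: side_def sgn_real_def)
    qed
    then show ?thesis using that(2) by (simp add: closure_chamber_eq)
  qed
  have "aff_dim (?H \<inter> ?V) = aff_dim ?H"
  proof (rule aff_dim_openin)
    show "openin (top_of_set ?H) (?H \<inter> ?V)" using \<open>open ?V\<close> by (simp add: openin_open_Int)
    show "affine ?H" unfolding dual_hyperplane_eq by (rule affine_hyperplane)
    have "x \<in> ?H \<inter> ?V" using i(3) x by (simp add: dual_hyperplane_eq)
    then show "?H \<inter> ?V \<noteq> {}" by blast
  qed
  moreover have "?H \<inter> ?V \<subseteq> ?W" using V_mem \<theta> \<eta> \<eta>_eq by blast
  then have "aff_dim (?H \<inter> ?V) \<le> aff_dim ?W" by (rule aff_dim_subset)
  moreover have "?W \<subseteq> ?H"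
    using closures_meet_in_separating_hyperplane[OF \<theta> \<eta>] i by blast
  then have "aff_dim ?W \<le> aff_dim ?H" by (rule aff_dim_subset)
  ultimately have "aff_dim ?W = aff_dim ?H" by linarith
  moreover have "\<exists>S. S \<noteq> {} \<and> S \<subseteq> maximal_cones M p \<and> ?W = \<Inter>S"
    using \<theta> \<eta> unfolding maximal_cones_eq
    by (intro exI[of _ "{closure (chamber M p \<theta>), closure (chamber M p \<eta>)}"]) auto
  ultimately show ?thesis unfolding is_wall_def aff_dim_dual_hyperplane by (rule conjI[rotated])
qed

section \<open>The loss along a path\<close>

lemma side_cases: "side q \<theta> \<in> {-1, 0, 1}"
  by (simp add: side_def sgn_real_def)

lemma err_one_flip:
  assumes i: "i \<in> {1..M}" "side (p i) \<theta> = - C i" "side (p i) \<eta> \<noteq> - C i"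
    and eq: "\<And>j. j \<in> {1..M} \<Longrightarrow> j \<noteq> i \<Longrightarrow> side (p j) \<theta> = side (p j) \<eta>"
  shows "err M p C \<theta> = Suc (err M p C \<eta>)"
proof -
  have "{j \<in> {1..M}. side (p j) \<theta> = - C j} = insert i {j \<in> {1..M}. side (p j) \<eta> = - C j}"
    using i eq by force
  then show ?thesis using i(3) by (simp add: err_eq_card_side)
qed

lemma wall_changes_err_by_one:
  fixes p :: "nat \<Rightarrow> real ^ 'd::finite"
  assumes inj: "inj_on p {1..M}" and C: "\<forall>i\<in>{1..M}. C i \<in> {-1, 1}"
    and "\<sigma> \<in> maximal_cones M p" "\<tau> \<in> maximal_cones M p" "is_wall M p (\<sigma> \<inter> \<tau>)"
  shows "\<bar>int (err_cone M p C \<sigma>) - int (err_cone M p C \<tau>)\<bar> = 1"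
proof -
  obtain \<theta> \<eta> where \<theta>: "\<theta> \<notin> arrangement M p" "\<sigma> = closure (chamber M p \<theta>)"
    and \<eta>: "\<eta> \<notin> arrangement M p" "\<tau> = closure (chamber M p \<eta>)"
    using assms(3,4) by (auto simp: maximal_cones_eq)
  obtain i where i: "i \<in> {1..M}" "side (p i) \<theta> \<noteq> side (p i) \<eta>"
    "\<And>j. j \<in> {1..M} \<Longrightarrow> j \<noteq> i \<Longrightarrow> side (p j) \<theta> = side (p j) \<eta>"
    using wall_flips_one_sign[OF inj \<theta>(1) \<eta>(1)] assms(5) \<theta>(2) \<eta>(2) by metis
  have "side (p i) \<theta> \<noteq> 0" "side (p i) \<eta> \<noteq> 0"
    using \<theta>(1) \<eta>(1) i(1) by (auto simp: notin_arrangement_iff)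
  then consider "side (p i) \<theta> = - C i" "side (p i) \<eta> \<noteq> - C i"
    | "side (p i) \<eta> = - C i" "side (p i) \<theta> \<noteq> - C i"
    using side_cases[of "p i" \<theta>] side_cases[of "p i" \<eta>] bspec[OF C i(1)] i(2) by auto
  then have "err M p C \<theta> = Suc (err M p C \<eta>) \<or> err M p C \<eta> = Suc (err M p C \<theta>)"
    using err_one_flip[OF i(1), of p \<theta> C \<eta>] err_one_flip[OF i(1), of p \<eta> C \<theta>] i(3) by (metis (no_types))
  then show ?thesis using \<theta> \<eta> by (auto simp: err_cone_chamber)
qed

lemma path_step_err:
  assumes "inj_on p {1..M}" "\<forall>i\<in>{1..M}. C i \<in> {-1, 1}"
    and "is_path M p \<sigma>s" "Suc i < length \<sigma>s"
  shows "\<bar>int (err_cone M p C (\<sigma>s ! i)) - int (err_cone M p C (\<sigma>s ! Suc i))\<bar> = 1"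
  using assms by (intro wall_changes_err_by_one) (auto simp: is_path_def dest: nth_mem)

lemma path_err_Lipschitz:
  assumes "inj_on p {1..M}" "\<forall>i\<in>{1..M}. C i \<in> {-1, 1}"
    and "is_path M p \<sigma>s" "i + n < length \<sigma>s"
  shows "\<bar>int (err_cone M p C (\<sigma>s ! i)) - int (err_cone M p C (\<sigma>s ! (i + n)))\<bar> \<le> int n"
  using assms(4)
proof (induction n)
  case (Suc n)
  then show ?case using path_step_err[OF assms(1-3), of "i + n"] by simp
qed simp

text \<open>
  The nearer end is at most half of all steps away, and each step raises the loss by at most one.
\<close>

lemma path_err_bound:
  assumes inj: "inj_on p {1..M}" and C: "\<forall>i\<in>{1..M}. C i \<in> {-1, 1}"
    and path: "is_path M p \<sigma>s"
    and ends: "err_cone M p C (hd \<sigma>s) = m" "err_cone M p C (last \<sigma>s) = m"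
    and "\<tau> \<in> set \<sigma>s"
  shows "err_cone M p C \<tau> \<le> m + (length \<sigma>s - 1) div 2"
proof -
  obtain j where j: "j < length \<sigma>s" "\<tau> = \<sigma>s ! j"
    using \<open>\<tau> \<in> set \<sigma>s\<close> by (auto simp: in_set_conv_nth)
  then have ne: "\<sigma>s \<noteq> []" by auto
  let ?n = "length \<sigma>s - 1 - j"
  have "\<bar>int m - int (err_cone M p C \<tau>)\<bar> \<le> int j"
    using path_err_Lipschitz[OF inj C path, of 0 j] j ends(1) ne by (simp add: hd_conv_nth)
  moreover have "\<bar>int (err_cone M p C \<tau>) - int m\<bar> \<le> int ?n"
    using path_err_Lipschitz[OF inj C path, of j ?n] j ends(2) ne by (simp add: last_conv_nth)
  moreover have "j + ?n = length \<sigma>s - 1" using j by simp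
  ultimately show ?thesis by linarith
qed

lemma equal_err_not_connected:
  assumes inj: "inj_on p {1..M}" and C: "\<forall>i\<in>{1..M}. C i \<in> {-1, 1}"
    and const: "\<And>\<sigma> \<tau>. \<sigma> \<in> S \<Longrightarrow> \<tau> \<in> S \<Longrightarrow> err_cone M p C \<sigma> = err_cone M p C \<tau>"
    and \<sigma>: "\<sigma> \<in> S \<inter> maximal_cones M p" and \<sigma>': "\<sigma>' \<in> S \<inter> maximal_cones M p" and "\<sigma> \<noteq> \<sigma>'"
  shows "\<not> connected_through_walls M p S"
proof
  assume "connected_through_walls M p S"
  then obtain \<sigma>s where \<sigma>s: "is_path M p \<sigma>s" "set \<sigma>s \<subseteq> S" "hd \<sigma>s = \<sigma>" "last \<sigma>s = \<sigma>'"
    using \<sigma> \<sigma>' unfolding connected_through_walls_def by blast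
  have "\<sigma>s \<noteq> []" using \<sigma>s(1) by (simp add: is_path_def)
  moreover have "length \<sigma>s \<noteq> 1"
    using \<sigma>s(3,4) \<open>\<sigma> \<noteq> \<sigma>'\<close> by (auto simp: length_Suc_conv)
  ultimately have len: "Suc 0 < length \<sigma>s" by (cases \<sigma>s) auto
  then have "\<sigma>s ! 0 \<in> S" "\<sigma>s ! Suc 0 \<in> S"
    using \<sigma>s(2) nth_mem[OF Suc_lessD[OF len]] nth_mem[OF len] by blast+
  then show False
    using path_step_err[OF inj C \<sigma>s(1) len] const[of "\<sigma>s ! 0" "\<sigma>s ! Suc 0"] by simp
qed

section \<open>Descent towards a separating parameter\<close>

text \<open>
  The crossing times with the hyperplanes \<open>i\<close> and \<open>j\<close> on the way from \<open>x\<close> to \<open>c\<close> agree only for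
  \<open>x\<close> on the hyperplane with normal \<open>(normal (p j) \<bullet> c) *\<^sub>R normal (p i) - (normal (p i) \<bullet> c) *\<^sub>R normal (p j)\<close>,
  which is a nonzero vector. Finitely many hyperplanes do not cover an open set.
\<close>

lemma generic_point_in_chamber:
  fixes p :: "nat \<Rightarrow> real ^ 'd::finite"
  assumes inj: "inj_on p {1..M}"
    and \<theta>: "\<theta> \<notin> arrangement M p" and c: "c \<notin> arrangement M p"
  obtains x where "x \<in> chamber M p \<theta>"
    "\<And>i j. i \<in> {1..M} \<Longrightarrow> j \<in> {1..M} \<Longrightarrow> i \<noteq> j \<Longrightarrow>
       (normal (p i) \<bullet> x) * (normal (p j) \<bullet> c) \<noteq> (normal (p j) \<bullet> x) * (normal (p i) \<bullet> c)"
proof -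
  let ?n = "\<lambda>i j. (normal (p j) \<bullet> c) *\<^sub>R normal (p i) - (normal (p i) \<bullet> c) *\<^sub>R normal (p j)"
  let ?I = "{ij \<in> {1..M} \<times> {1..M}. fst ij \<noteq> snd ij}"
  let ?B = "\<Union>(i, j)\<in>?I. {x. ?n i j \<bullet> x = 0}"
  have n: "?n i j \<noteq> 0" if "i \<in> {1..M}" "j \<in> {1..M}" "i \<noteq> j" for i j
  proof
    assume 0: "?n i j = 0"
    have "p i \<noteq> p j" using inj that by (auto dest: inj_onD)
    moreover have "normal (p j) \<bullet> c = normal (p i) \<bullet> c"
      using arg_cong[OF 0, of fst] by (simp add: normal_def)
    moreover have "(normal (p j) \<bullet> c) *\<^sub>R p i = (normal (p i) \<bullet> c) *\<^sub>R p j"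
      using arg_cong[OF 0, of snd] by (simp add: normal_def)
    ultimately have "normal (p i) \<bullet> c = 0" by simp
    then show False using c that by (simp add: notin_arrangement_iff side_eq_0_iff)
  qed
  have "finite ?I" by simp
  moreover have "negligible {x. ?n i j \<bullet> x = 0}" if "(i, j) \<in> ?I" for i j
    using n[of i j] that by (intro negligible_hyperplane) auto
  ultimately have "negligible ?B"
    by (intro negligible_Union finite_imageI) auto
  moreover have "\<not> negligible (chamber M p \<theta>)"
    using open_convex_chamber(1)[OF \<theta>] self_in_chamber[of \<theta> M p] by (intro open_not_negligible) blast+
  ultimately obtain x where x: "x \<in> chamber M p \<theta>" "x \<notin> ?B"
    using negligible_subset by blast
  show thesis
  proof (rule that[OF x(1)])
    fix i j assume "i \<in> {1..M}" "j \<in> {1..M}" "i \<noteq> j"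
    then have "?n i j \<bullet> x \<noteq> 0" using x(2) by force
    then show "(normal (p i) \<bullet> x) * (normal (p j) \<bullet> c) \<noteq> (normal (p j) \<bullet> x) * (normal (p i) \<bullet> c)"
      by (simp add: inner_diff_left mult.commute)
  qed
qed

text \<open>
  Here \<open>f i\<close> and \<open>g i\<close> are the values of the \<open>i\<close>-th linear functional at the two ends of a segment,
  so the functional takes the value \<open>(1 - t) * f i + t * g i\<close> at time \<open>t\<close>. The time \<open>t\<close> is that of
  the earliest sign change, and the inequality of the products rules out that two functionals
  vanish at the same time.
\<close>

lemma first_crossing:
  fixes f g :: "nat \<Rightarrow> real"
  assumes "finite I" "\<And>i. i \<in> I \<Longrightarrow> f i \<noteq> 0" "\<And>i. i \<in> I \<Longrightarrow> g i \<noteq> 0"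
    and neq: "\<And>i j. i \<in> I \<Longrightarrow> j \<in> I \<Longrightarrow> i \<noteq> j \<Longrightarrow> f i * g j \<noteq> f j * g i"
    and ex: "\<exists>i\<in>I. sgn (f i) \<noteq> sgn (g i)"
  obtains i t where "i \<in> I" "sgn (f i) \<noteq> sgn (g i)" "(1 - t) * f i + t * g i = 0"
    "\<And>j. j \<in> I \<Longrightarrow> j \<noteq> i \<Longrightarrow> sgn ((1 - t) * f j + t * g j) = sgn (f j)"
proof -
  define D where "D = {i \<in> I. sgn (f i) \<noteq> sgn (g i)}"
  \<comment> \<open>The affine function with value \<open>f i\<close> at \<open>0\<close> and \<open>g i\<close> at \<open>1\<close> vanishes at \<open>T i\<close>.\<close>
  define T where "T i = f i / (f i - g i)" for i
  have D: "f i < 0 \<and> 0 < g i \<or> g i < 0 \<and> 0 < f i" if "i \<in> D" for i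
    using that assms(2,3)[of i] by (auto simp: D_def sgn_real_def split: if_splits)
  have T: "0 < T i" "T i < 1" "f i = T i * (f i - g i)" if "i \<in> D" for i
    using D[OF that] by (auto simp: T_def field_simps)
  have "finite D" "D \<noteq> {}" using assms(1) ex by (auto simp: D_def)
  then obtain i where i: "i \<in> D" "\<And>j. j \<in> D \<Longrightarrow> T i \<le> T j"
    using ex_min_if_finite[of "T ` D"] by (metis (no_types, lifting) finite_imageI image_is_empty
        imageE imageI not_le)
  let ?t = "T i"
  show thesis
  proof (rule that[of i ?t])
    show "i \<in> I" "sgn (f i) \<noteq> sgn (g i)" using i by (auto simp: D_def)
    show "(1 - ?t) * f i + ?t * g i = 0" using T(3)[OF i(1)] by (simp add: algebra_simps)
    fix j assume j: "j \<in> I" "j \<noteq> i"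
    show "sgn ((1 - ?t) * f j + ?t * g j) = sgn (f j)"
    proof (cases "j \<in> D")
      case False
      then have "sgn (f j) = sgn (g j)" using j by (simp add: D_def)
      then have "0 < f j \<and> 0 < g j \<or> f j < 0 \<and> g j < 0"
        using assms(2)[OF j(1)] by (auto simp: sgn_real_def split: if_splits)
      then show ?thesis
        using T(1,2)[OF i(1)]
        by (auto simp: add_pos_pos add_neg_neg mult_pos_neg)
    next
      case True
      have "f i * g j \<noteq> f j * g i" using neq j i by (auto simp: D_def)
      then have "T j \<noteq> ?t"
        using D[OF True] D[OF i(1)] by (auto simp: T_def field_simps)
      then have "?t < T j" using i(2)[OF True] by simp
      moreover have "(1 - ?t) * f j + ?t * g j = (T j - ?t) * (f j - g j)"
        using T(3)[OF True] by (simp add: algebra_simps)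
      moreover have "sgn (f j - g j) = sgn (f j)"
        using D[OF True] by (auto simp: sgn_real_def)
      ultimately show ?thesis by (simp add: sgn_mult)
    qed
  qed
qed

text \<open>
  The target \<open>c\<close> may be any point of another chamber: one sign can always be changed to that of
  \<open>c\<close>. If \<open>c\<close> separates the data, this corrects a misclassified point.
\<close>

lemma descent_towards_separator:
  fixes p :: "nat \<Rightarrow> real ^ 'd::finite"
  assumes inj: "inj_on p {1..M}"
    and \<theta>: "\<theta> \<notin> arrangement M p" and c: "c \<notin> arrangement M p"
    and c_notin: "c \<notin> chamber M p \<theta>"
  obtains \<eta> i where "\<eta> \<notin> arrangement M p"
    "is_wall M p (closure (chamber M p \<theta>) \<inter> closure (chamber M p \<eta>))"
    "i \<in> {1..M}" "side (p i) \<theta> \<noteq> side (p i) c" "side (p i) \<eta> = side (p i) c"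
    "\<And>j. j \<in> {1..M} \<Longrightarrow> j \<noteq> i \<Longrightarrow> side (p j) \<theta> = side (p j) \<eta>"
proof -
  obtain x where x: "x \<in> chamber M p \<theta>" and gen: "\<And>i j. i \<in> {1..M} \<Longrightarrow> j \<in> {1..M} \<Longrightarrow> i \<noteq> j \<Longrightarrow>
       (normal (p i) \<bullet> x) * (normal (p j) \<bullet> c) \<noteq> (normal (p j) \<bullet> x) * (normal (p i) \<bullet> c)"
    using generic_point_in_chamber[OF inj \<theta> c] by blast
  have xs: "side (p i) x = side (p i) \<theta>" if "i \<in> {1..M}" for i
    using x that by (simp add: chamber_def)
  have xA: "x \<notin> arrangement M p" using chamber_disjoint_arrangement[OF \<theta> x] .
  have ex': "\<exists>i\<in>{1..M}. sgn (normal (p i) \<bullet> x) \<noteq> sgn (normal (p i) \<bullet> c)"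
    using c_notin xs by (force simp: chamber_def side_def)
  obtain i t where i: "i \<in> {1..M}" "side (p i) x \<noteq> side (p i) c"
    and t: "(1 - t) * (normal (p i) \<bullet> x) + t * (normal (p i) \<bullet> c) = 0"
    and others: "\<And>j. j \<in> {1..M} \<Longrightarrow> j \<noteq> i \<Longrightarrow>
       sgn ((1 - t) * (normal (p j) \<bullet> x) + t * (normal (p j) \<bullet> c)) = sgn (normal (p j) \<bullet> x)"
  proof (rule first_crossing[of "{1..M}" "\<lambda>i. normal (p i) \<bullet> x" "\<lambda>i. normal (p i) \<bullet> c"])
    show "normal (p i) \<bullet> x \<noteq> 0" "normal (p i) \<bullet> c \<noteq> 0" if "i \<in> {1..M}" for i
      using xA c that by (auto simp: notin_arrangement_iff side_eq_0_iff)
  qed (use gen ex' that in \<open>auto simp: side_def\<close>)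
  define z where "z = (1 - t) *\<^sub>R x + t *\<^sub>R c"
  have z: "normal (p j) \<bullet> z = (1 - t) * (normal (p j) \<bullet> x) + t * (normal (p j) \<bullet> c)" for j
    by (simp add: z_def inner_add_right)
  have zi: "normal (p i) \<bullet> z = 0" using z t by simp
  have zj: "side (p j) z = side (p j) \<theta>" if "j \<in> {1..M} - {i}" for j
    using that others[of j] xs[of j] by (simp add: side_def z)
  have ci: "normal (p i) \<bullet> c \<noteq> 0"
    using c i by (auto simp: notin_arrangement_iff side_eq_0_iff)
  \<comment> \<open>A point shortly behind the crossing point \<open>z\<close> lies in the next chamber.\<close>
  let ?V = "{y. \<forall>j\<in>{1..M} - {i}. side (p j) y = side (p j) \<theta>}"
  have "open ?V"
    using \<theta> by (intro open_convex_same_sides) (auto simp: notin_arrangement_iff)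
  moreover have "z \<noteq> c" using zi ci by metis
  then have "z \<in> closure (open_segment z c)" by (simp add: closure_open_segment)
  moreover have "z \<in> ?V" using zj by blast
  ultimately have "?V \<inter> open_segment z c \<noteq> {}"
    using open_Int_closure_eq_empty[of ?V "open_segment z c"] by blast
  then obtain \<eta> where \<eta>: "\<eta> \<in> ?V" "\<eta> \<in> open_segment z c" by blast
  then obtain u where u: "0 < u" "\<eta> = (1 - u) *\<^sub>R z + u *\<^sub>R c"
    by (auto simp: in_segment)
  have "normal (p i) \<bullet> \<eta> = u * (normal (p i) \<bullet> c)"
    using zi by (simp add: u(2) inner_add_right)
  then have \<eta>i: "side (p i) \<eta> = side (p i) c"
    using u(1) by (simp add: side_def sgn_mult)
  have \<eta>j: "side (p j) \<eta> = side (p j) \<theta>" if "j \<in> {1..M} - {i}" for j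
    using \<eta>(1) that by blast
  have \<eta>A: "\<eta> \<notin> arrangement M p"
    using \<eta>i \<eta>j \<theta> c i(1) unfolding notin_arrangement_iff by (metis DiffI singletonD)
  have neq: "side (p i) \<theta> \<noteq> side (p i) c" using i xs by simp
  show thesis
  proof (rule that[OF \<eta>A _ i(1) neq \<eta>i])
    show "is_wall M p (closure (chamber M p \<theta>) \<inter> closure (chamber M p \<eta>))"
      using neq \<eta>i by (intro is_wall_one_flip[OF \<theta> \<eta>A i(1) _ zi zj \<eta>j]) auto
  qed (use \<eta>j in auto)
qed

section \<open>Connectedness of sublevel sets\<close>

text \<open>
  Restricting both cones to \<open>S\<close> makes the reflexive transitive closure express paths inside \<open>S\<close>.
\<close>

definition adjacent_in ::
    "nat \<Rightarrow> (nat \<Rightarrow> real ^ 'd::finite) \<Rightarrow> 'd param set set \<Rightarrow> 'd param set \<Rightarrow> 'd param set \<Rightarrow> bool" where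
  "adjacent_in M p S \<sigma> \<tau> \<longleftrightarrow>
     \<sigma> \<in> S \<inter> maximal_cones M p \<and> \<tau> \<in> S \<inter> maximal_cones M p \<and> is_wall M p (\<sigma> \<inter> \<tau>)"

lemma path_of_rtranclp_adjacent_in:
  assumes "(adjacent_in M p S)\<^sup>*\<^sup>* \<sigma> \<tau>" "\<tau> \<in> S \<inter> maximal_cones M p"
  shows "\<exists>\<sigma>s. is_path M p \<sigma>s \<and> set \<sigma>s \<subseteq> S \<and> hd \<sigma>s = \<sigma> \<and> last \<sigma>s = \<tau>"
  using assms(1)
proof (induction rule: converse_rtranclp_induct)
  case base
  show ?case using assms(2) by (intro exI[of _ "[\<tau>]"]) (auto simp: is_path_def)
next
  case (step \<rho> \<sigma>)
  then obtain \<sigma>s where \<sigma>s: "is_path M p \<sigma>s" "set \<sigma>s \<subseteq> S" "hd \<sigma>s = \<sigma>" "last \<sigma>s = \<tau>" by blast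
  have "is_path M p (\<rho> # \<sigma>s)"
    unfolding is_path_def
  proof (intro conjI allI impI)
    fix i assume "Suc i < length (\<rho> # \<sigma>s)"
    then show "is_wall M p ((\<rho> # \<sigma>s) ! i \<inter> (\<rho> # \<sigma>s) ! Suc i)"
      using \<sigma>s step(1) by (cases i) (auto simp: is_path_def adjacent_in_def hd_conv_nth)
  qed (use \<sigma>s step(1) in \<open>auto simp: is_path_def adjacent_in_def\<close>)
  moreover have "\<sigma>s \<noteq> []" using \<sigma>s(1) by (simp add: is_path_def)
  ultimately show ?case
    using \<sigma>s step(1) by (intro exI[of _ "\<rho> # \<sigma>s"]) (auto simp: adjacent_in_def)
qed

text \<open>Adjacency is symmetric, so any two cones can be joined via a common endpoint \<open>\<kappa>\<close>.\<close>

lemma connected_through_walls_hub: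
  assumes "\<And>\<sigma>. \<sigma> \<in> S \<inter> maximal_cones M p \<Longrightarrow> (adjacent_in M p S)\<^sup>*\<^sup>* \<sigma> \<kappa>"
  shows "connected_through_walls M p S"
  unfolding connected_through_walls_def
proof (intro ballI)
  fix \<sigma> \<sigma>' assume \<sigma>: "\<sigma> \<in> S \<inter> maximal_cones M p" and \<sigma>': "\<sigma>' \<in> S \<inter> maximal_cones M p"
  have "symp (adjacent_in M p S)"
    by (auto simp: symp_def adjacent_in_def Int_commute)
  then have "(adjacent_in M p S)\<^sup>*\<^sup>* \<kappa> \<sigma>'"
    using assms[OF \<sigma>'] by (meson symp_rtranclp sympD)
  with assms[OF \<sigma>] have "(adjacent_in M p S)\<^sup>*\<^sup>* \<sigma> \<sigma>'" by (rule rtranclp_trans)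
  then show "\<exists>\<sigma>s. is_path M p \<sigma>s \<and> set \<sigma>s \<subseteq> S \<and> hd \<sigma>s = \<sigma> \<and> last \<sigma>s = \<sigma>'"
    using \<sigma>' by (rule path_of_rtranclp_adjacent_in)
qed

lemma sublevel_set_chamber_connected_to_separator:
  fixes p :: "nat \<Rightarrow> real ^ 'd::finite"
  assumes inj: "inj_on p {1..M}" and C: "\<forall>i\<in>{1..M}. C i \<in> {-1, 1}"
    and c: "\<forall>i\<in>{1..M}. side (p i) c = C i"
    and "\<theta> \<notin> arrangement M p" "err M p C \<theta> \<le> k"
  shows "(adjacent_in M p (sublevel_set M p C k))\<^sup>*\<^sup>*
           (closure (chamber M p \<theta>)) (closure (chamber M p c))"
  using assms(4,5)
proof (induction "err M p C \<theta>" arbitrary: \<theta> rule: less_induct)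
  case less
  have cA: "c \<notin> arrangement M p"
    unfolding notin_arrangement_iff
  proof
    fix i assume "i \<in> {1..M}"
    then show "side (p i) c \<noteq> 0" using bspec[OF c] bspec[OF C] by fastforce
  qed
  show ?case
  proof (cases "c \<in> chamber M p \<theta>")
    case True
    then show ?thesis by (simp add: chamber_eq)
  next
    case False
    then obtain \<eta> i where \<eta>: "\<eta> \<notin> arrangement M p"
      "is_wall M p (closure (chamber M p \<theta>) \<inter> closure (chamber M p \<eta>))"
      and i: "i \<in> {1..M}" "side (p i) \<theta> \<noteq> side (p i) c" "side (p i) \<eta> = side (p i) c"
      "\<And>j. j \<in> {1..M} \<Longrightarrow> j \<noteq> i \<Longrightarrow> side (p j) \<theta> = side (p j) \<eta>"
      using descent_towards_separator[OF inj less.prems(1) cA] by blast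
    have "side (p i) \<theta> \<noteq> 0" using less.prems(1) i(1) by (simp add: notin_arrangement_iff)
    then have "side (p i) \<theta> = - C i" "side (p i) \<eta> \<noteq> - C i"
      using side_cases[of "p i" \<theta>] i bspec[OF c i(1)] bspec[OF C i(1)] by auto
    then have err: "err M p C \<theta> = Suc (err M p C \<eta>)"
      using err_one_flip[OF i(1)] i(4) by blast
    have mem: "closure (chamber M p \<zeta>) \<in> sublevel_set M p C k \<inter> maximal_cones M p"
      if "\<zeta> \<notin> arrangement M p" "err M p C \<zeta> \<le> k" for \<zeta>
    proof -
      have "closure (chamber M p \<zeta>) \<in> maximal_cones M p"
        using that(1) by (auto simp: maximal_cones_eq)
      then show ?thesis
        using that by (simp add: maximal_cone_in_sublevel_set_iff err_cone_chamber)
    qed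
    have "adjacent_in M p (sublevel_set M p C k)
        (closure (chamber M p \<theta>)) (closure (chamber M p \<eta>))"
      using mem[of \<theta>] mem[of \<eta>] \<eta> less.prems err by (simp add: adjacent_in_def)
    moreover have "(adjacent_in M p (sublevel_set M p C k))\<^sup>*\<^sup>*
        (closure (chamber M p \<eta>)) (closure (chamber M p c))"
      using less.hyps[of \<eta>] \<eta>(1) err less.prems(2) by simp
    ultimately show ?thesis by (rule converse_rtranclp_into_rtranclp)
  qed
qed

lemma sublevel_set_connected:
  fixes p :: "nat \<Rightarrow> real ^ 'd::finite"
  assumes inj: "inj_on p {1..M}" and C: "\<forall>i\<in>{1..M}. C i \<in> {-1, 1}"
    and "linearly_separable M p C"
  shows "connected_through_walls M p (sublevel_set M p C k)"
proof -
  obtain c where c: "\<forall>i\<in>{1..M}. side (p i) c = C i"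
    using assms(3) by (auto simp: linearly_separable_def classifier_eq_side)
  show ?thesis
  proof (rule connected_through_walls_hub[where \<kappa> = "closure (chamber M p c)"])
    fix \<sigma> assume \<sigma>: "\<sigma> \<in> sublevel_set M p C k \<inter> maximal_cones M p"
    then obtain \<theta> where \<theta>: "\<theta> \<notin> arrangement M p" "\<sigma> = closure (chamber M p \<theta>)"
      by (auto simp: maximal_cones_eq)
    have "err M p C \<theta> \<le> k"
      using \<sigma> \<theta> by (auto simp: maximal_cone_in_sublevel_set_iff err_cone_chamber)
    then show "(adjacent_in M p (sublevel_set M p C k))\<^sup>*\<^sup>* \<sigma> (closure (chamber M p c))"
      unfolding \<theta>(2) by (rule sublevel_set_chamber_connected_to_separator[OF inj C c \<theta>(1)])
  qed
qed

theorem theorem2p3: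
  fixes M :: nat and p :: "nat \<Rightarrow> real ^ 'd::finite" and C :: "nat \<Rightarrow> real"
  assumes "inj_on p {1..M}"
    and "\<And>i. i \<in> {1..M} \<Longrightarrow> C i \<in> {-1, 1}"
  shows "(linearly_separable M p C \<longrightarrow>
            (\<forall>k. connected_through_walls M p (sublevel_set M p C k)))
       \<and> (\<not> linearly_separable M p C \<and>
            (\<exists>\<sigma>\<in>minimizers M p C. \<exists>\<sigma>'\<in>minimizers M p C. \<sigma> \<noteq> \<sigma>') \<longrightarrow>
            \<not> connected_through_walls M p (minimizers M p C))
       \<and> (\<forall>\<sigma> \<sigma>' \<sigma>s m.
            local_minimum M p C \<sigma> \<and> local_minimum M p C \<sigma>' \<and> \<sigma> \<noteq> \<sigma>' \<and>
            err_cone M p C \<sigma> = m \<and> err_cone M p C \<sigma>' = m \<and>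
            is_path M p (\<sigma> # \<sigma>s @ [\<sigma>']) \<longrightarrow>
            (\<forall>\<tau>\<in>set (\<sigma> # \<sigma>s @ [\<sigma>']). err_cone M p C \<tau> \<le> m + (length \<sigma>s + 1) div 2))"
proof -
  have C: "\<forall>i\<in>{1..M}. C i \<in> {-1, 1}" using assms(2) by blast
  show ?thesis
  proof (intro conjI)
    show "linearly_separable M p C \<longrightarrow>
        (\<forall>k. connected_through_walls M p (sublevel_set M p C k))"
      using sublevel_set_connected[OF assms(1) C] by blast
  next
    have "\<not> connected_through_walls M p (minimizers M p C)"
      if "\<sigma> \<in> minimizers M p C" "\<sigma>' \<in> minimizers M p C" "\<sigma> \<noteq> \<sigma>'" for \<sigma> \<sigma>'
      using that
      by (intro equal_err_not_connected[OF assms(1) C, of _ \<sigma> \<sigma>']) (auto simp: minimizers_def intro: order_antisym)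
    then show "\<not> linearly_separable M p C \<and>
        (\<exists>\<sigma>\<in>minimizers M p C. \<exists>\<sigma>'\<in>minimizers M p C. \<sigma> \<noteq> \<sigma>') \<longrightarrow>
        \<not> connected_through_walls M p (minimizers M p C)"
      by blast
  next
    have "err_cone M p C \<tau> \<le> m + (length \<sigma>s + 1) div 2"
      if "is_path M p (\<sigma> # \<sigma>s @ [\<sigma>'])" "err_cone M p C \<sigma> = m" "err_cone M p C \<sigma>' = m"
        "\<tau> \<in> set (\<sigma> # \<sigma>s @ [\<sigma>'])" for \<sigma> \<sigma>' \<sigma>s m \<tau>
      using path_err_bound[OF assms(1) C that(1) _ _ that(4)] that(2,3) by simp
    then show "\<forall>\<sigma> \<sigma>' \<sigma>s m.
        local_minimum M p C \<sigma> \<and> local_minimum M p C \<sigma>' \<and> \<sigma> \<noteq> \<sigma>' \<and>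
        err_cone M p C \<sigma> = m \<and> err_cone M p C \<sigma>' = m \<and>
        is_path M p (\<sigma> # \<sigma>s @ [\<sigma>']) \<longrightarrow>
        (\<forall>\<tau>\<in>set (\<sigma> # \<sigma>s @ [\<sigma>']). err_cone M p C \<tau> \<le> m + (length \<sigma>s + 1) div 2)"
      by blast
  qed
qed

end
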